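(* Let $k,r$ be positive integers and $h=3$, such that $\ell=\frac{k+3}{r}$ is an integer. Let $m$ be the smallest even integer such that $\ell\le 2^{rm}$. Then there exists a maximally recoverable local $(k,r,3)$-code over the field $\mathbb{F}_{2^t}$, where $t=r\left(\frac{3m}{2}+1\right)$.
   Context: For positive integers $k,r,h$ with $r\mid(k+h)$, a local $(k,r,h)$-code over a finite field $\mathbb{F}$ is a linear systematic code of dimension $k$ and length $k+h+\frac{k+h}{r}$ consisting of $k$ data symbols, $h$ heavy parity symbols (each a fixed $\mathbb{F}$-linear combination of all data symbols), and, after partitioning the $k+h$ data and heavy parity symbols into $\frac{k+h}{r}$ groups of size $r$, one local parity per group equal to the sum (XOR) of the group's symbols. A local group is such a group together with its local parity. The code is maximally recoverable if for every set $E$ of coordinates containing exactly one coordinate from each local group, puncturing the code in $E$ yields a maximum distance separable $[k+h,k]$ code (minimum distance $h+1$). *)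

theory Defs
  imports Main
begin

text \<open>Coordinates of a local (k,r,h)-code: 0..<k data symbols, k..<k+h heavy parities,
  k+h+g (g < (k+h) div r) local parity of group g.  A code is given by
  a group assignment grp (of the k+h data/heavy symbols to groups 0..<(k+h) div r)
  and heavy-parity coefficients Cf j i (heavy parity j, data symbol i).\<close>

definition num_groups :: "nat \<Rightarrow> nat \<Rightarrow> nat \<Rightarrow> nat" where
  "num_groups k r h = (k + h) div r"

definition code_length :: "nat \<Rightarrow> nat \<Rightarrow> nat \<Rightarrow> nat" where
  "code_length k r h = k + h + num_groups k r h"

definition dh_symbol :: "nat \<Rightarrow> (nat \<Rightarrow> nat \<Rightarrow> 'a::field) \<Rightarrow> (nat \<Rightarrow> 'a) \<Rightarrow> nat \<Rightarrow> 'a" where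
  "dh_symbol k Cf x i = (if i < k then x i else (\<Sum>j<k. Cf (i - k) j * x j))"

definition codeword :: "nat \<Rightarrow> nat \<Rightarrow> nat \<Rightarrow> (nat \<Rightarrow> nat) \<Rightarrow> (nat \<Rightarrow> nat \<Rightarrow> 'a::field)
    \<Rightarrow> (nat \<Rightarrow> 'a) \<Rightarrow> nat \<Rightarrow> 'a" where
  "codeword k r h grp Cf x i =
     (if i < k + h then dh_symbol k Cf x i
      else if i < code_length k r h then
        (\<Sum>j\<in>{j. j < k + h \<and> grp j = i - (k + h)}. dh_symbol k Cf x j)
      else 0)"

definition is_local_code_structure :: "nat \<Rightarrow> nat \<Rightarrow> nat \<Rightarrow> (nat \<Rightarrow> nat) \<Rightarrow> bool" where
  "is_local_code_structure k r h grp \<longleftrightarrow>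
     0 < r \<and> r dvd (k + h) \<and>
     (\<forall>i < k + h. grp i < num_groups k r h) \<and>
     (\<forall>g < num_groups k r h. card {i. i < k + h \<and> grp i = g} = r)"

definition local_group :: "nat \<Rightarrow> nat \<Rightarrow> nat \<Rightarrow> (nat \<Rightarrow> nat) \<Rightarrow> nat \<Rightarrow> nat set" where
  "local_group k r h grp g = {i. i < k + h \<and> grp i = g} \<union> {k + h + g}"

text \<open>Hamming weight on coordinate set S and minimum distance of a code C
  whose words are supported on S.\<close>
definition weight_on :: "nat set \<Rightarrow> (nat \<Rightarrow> 'a::zero) \<Rightarrow> nat" where
  "weight_on S w = card {i \<in> S. w i \<noteq> 0}"

definition min_distance :: "nat set \<Rightarrow> (nat \<Rightarrow> 'a::zero) set \<Rightarrow> nat" where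
  "min_distance S C = Min {weight_on S w | w. w \<in> C \<and> w \<noteq> (\<lambda>_. 0)}"

text \<open>A linear code C on coordinates S (|S| = n) over finite field 'a is an MDS [n,kk] code:
  dimension kk (i.e. q^kk codewords) and minimum distance n - kk + 1.\<close>
definition is_MDS_code :: "nat set \<Rightarrow> (nat \<Rightarrow> 'a::{finite,field}) set \<Rightarrow> nat \<Rightarrow> nat \<Rightarrow> bool" where
  "is_MDS_code S C n kk \<longleftrightarrow>
     card S = n \<and> card C = card (UNIV :: 'a set) ^ kk \<and> min_distance S C = n - kk + 1"

definition punctured_code :: "nat \<Rightarrow> nat \<Rightarrow> nat \<Rightarrow> (nat \<Rightarrow> nat) \<Rightarrow> (nat \<Rightarrow> nat \<Rightarrow> 'a::field)
    \<Rightarrow> nat set \<Rightarrow> (nat \<Rightarrow> 'a) set" where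
  "punctured_code k r h grp Cf E =
     {(\<lambda>i. if i \<in> {0..<code_length k r h} - E then codeword k r h grp Cf x i else 0) | x. True}"

definition maximally_recoverable :: "nat \<Rightarrow> nat \<Rightarrow> nat \<Rightarrow> (nat \<Rightarrow> nat)
    \<Rightarrow> (nat \<Rightarrow> nat \<Rightarrow> 'a::{finite,field}) \<Rightarrow> bool" where
  "maximally_recoverable k r h grp Cf \<longleftrightarrow>
     (\<forall>E. E \<subseteq> {0..<code_length k r h} \<and>
          (\<forall>g < num_groups k r h. card (E \<inter> local_group k r h grp g) = 1) \<longrightarrow>
          is_MDS_code ({0..<code_length k r h} - E) (punctured_code k r h grp Cf E) (k + h) k)"

end

theory Submission
  imports Defs "HOL-Computational_Algebra.Polynomial" "HOL-Library.FuncSet"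
begin

text \<open>Give each symbol a coefficient \<open>a\<close> (local parities get \<open>0\<close>) and let the heavy checks be
  \<open>\<Sum>i. a i ^ (2 ^ j) * y i = 0\<close> for \<open>j < 3\<close>. After one erasure per group is eliminated by the local
  checks, three further erasures are correctable iff the corresponding differences
  \<open>a i + a (e g)\<close> (\<open>e g\<close> the erased symbol of the group \<open>g\<close> of \<open>i\<close>) are linearly independent over
  the prime field, by a Moore determinant argument. The field is a vector space of dimension
  \<open>3 m / 2 + 1\<close> over its subfield \<open>K\<close> with \<open>q = 2 ^ r\<close> elements. Take the \<open>a i\<close> of a group to be
  a basis of \<open>K\<close> over the prime field, times one vector \<open>P g\<close>; then it suffices that any three of
  the \<open>P g\<close> are linearly independent over \<open>K\<close>, i.e.\ that they form a cap. A product of \<open>m / 2\<close>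
  affine elliptic quadrics \<open>z = N(x, y)\<close>, with \<open>N\<close> an anisotropic form, is a cap with \<open>q ^ m\<close>
  points.\<close>

section \<open>Finite fields of characteristic two\<close>

text \<open>Multiplication by a nonzero \<open>x\<close> permutes the nonzero elements; cancelling
  their product leaves \<open>x ^ (card UNIV - 1) = 1\<close>.\<close>

lemma power_card_UNIV_eq:
  fixes x :: "'a::{finite,field}"
  shows "x ^ card (UNIV :: 'a set) = x"
proof (cases "x = 0")
  case True
  then show ?thesis by (simp add: finite_UNIV_card_ge_0)
next
  case False
  have "(\<Prod>y\<in>UNIV-{0}. x * y) = (\<Prod>y\<in>UNIV-{0}. y)"
    by (rule prod.reindex_bij_witness[of _ "\<lambda>y. y / x" "\<lambda>y. x * y"]) (use False in auto)
  then have "x ^ (card (UNIV :: 'a set) - 1) = 1"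
    by (simp add: prod.distrib)
  then show ?thesis
    by (metis finite_UNIV_card_ge_0 finite mult.right_neutral power_eq_if not_gr_zero)
qed

text \<open>An even power of \<open>-1\<close> is \<open>1\<close>, while raising to the field order
  fixes \<open>-1\<close>.\<close>

lemma two_eq_0_if_card_even:
  assumes "even (card (UNIV :: 'a::{finite,field} set))"
  shows "(2::'a) = 0"
proof -
  have "(-1::'a) = 1"
    using power_card_UNIV_eq[of "-1::'a"] assms by simp
  then show ?thesis
    by (metis add.right_inverse one_add_one)
qed

context
  assumes two: "(2::'a::field) = 0"
begin

lemma char2_add_self: "x + x = (0::'a)"
  using two by (metis mult_2 mult_zero_left)

lemma char2_minus: "- x = (x::'a)"
  using char2_add_self[of x] by (simp add: eq_neg_iff_add_eq_0 [symmetric])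

lemma char2_add_power: "(x + y) ^ (2 ^ j) = x ^ (2 ^ j) + (y::'a) ^ (2 ^ j)"
proof (induction j)
  case (Suc j)
  have "(x + y) ^ (2 ^ Suc j) = ((x + y) ^ (2 ^ j))\<^sup>2"
    by (simp add: power_mult [symmetric] mult.commute)
  also have "\<dots> = (x ^ (2 ^ j))\<^sup>2 + (y ^ (2 ^ j))\<^sup>2"
    by (simp add: Suc power2_sum two)
  finally show ?case
    by (simp add: power_mult [symmetric] mult.commute)
qed simp

text \<open>The three equations combine to \<open>L a * u = 0\<close> for the linearised polynomial
  \<open>L X = X (X + b) (X + c) (X + b + c) = X\<^sup>4 + (b\<^sup>2 + b c + c\<^sup>2) X\<^sup>2 + (b\<^sup>2 c + b c\<^sup>2) X\<close>,
  which vanishes at \<open>b\<close> and \<open>c\<close>.\<close>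
lemma moore3_first_eq_0:
  fixes a b c u v w :: 'a
  assumes "a \<noteq> 0" "a + b \<noteq> 0" "a + c \<noteq> 0" "a + b + c \<noteq> 0"
    and "a * u + b * v + c * w = 0"
    and "a\<^sup>2 * u + b\<^sup>2 * v + c\<^sup>2 * w = 0"
    and "a ^ 4 * u + b ^ 4 * v + c ^ 4 * w = 0"
  shows "u = 0"
proof -
  \<comment> \<open>\<open>algebra\<close> proves an identity valid over every commutative ring; the
    last summand collects the discrepancy, which is a multiple of 2.\<close>
  have "a * (a + b) * (a + c) * (a + b + c) * u =
      (a ^ 4 * u + b ^ 4 * v + c ^ 4 * w)
      + (b\<^sup>2 + b * c + c\<^sup>2) * (a\<^sup>2 * u + b\<^sup>2 * v + c\<^sup>2 * w)
      + (b\<^sup>2 * c + b * c\<^sup>2) * (a * u + b * v + c * w)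
      + 2 * (((b + c) * a ^ 3 + b * c * a\<^sup>2) * u
        - (b ^ 4 + b\<^sup>2 * c\<^sup>2 + b ^ 3 * c) * v - (c ^ 4 + b\<^sup>2 * c\<^sup>2 + b * c ^ 3) * w)"
    by algebra
  then have "a * (a + b) * (a + c) * (a + b + c) * u = 0"
    using assms(5-7) two by simp
  then show ?thesis using assms(1-4) by simp
qed

end

text \<open>Subfields are subsets of one field type, so that the same linear algebra serves both the
  prime field and the field with \<open>2 ^ r\<close> elements.\<close>

locale subfield_set =
  fixes K :: "'a::field set"
  assumes zero: "0 \<in> K" and one: "1 \<in> K"
    and add: "x \<in> K \<Longrightarrow> y \<in> K \<Longrightarrow> x + y \<in> K"
    and uminus: "x \<in> K \<Longrightarrow> - x \<in> K"
    and mult: "x \<in> K \<Longrightarrow> y \<in> K \<Longrightarrow> x * y \<in> K"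
    and inverse: "x \<in> K \<Longrightarrow> inverse x \<in> K"
begin

lemma divide: "x \<in> K \<Longrightarrow> y \<in> K \<Longrightarrow> x / y \<in> K"
  by (simp add: divide_inverse mult inverse)

lemma sum: "(\<And>i. i \<in> A \<Longrightarrow> f i \<in> K) \<Longrightarrow> sum f A \<in> K"
  by (induction A rule: infinite_finite_induct) (auto simp: zero add)

definition independent :: "(nat \<Rightarrow> 'a) \<Rightarrow> nat \<Rightarrow> bool" where
  "independent b n \<longleftrightarrow>
     (\<forall>c. (\<forall>i<n. c i \<in> K) \<longrightarrow> (\<Sum>i<n. c i * b i) = 0 \<longrightarrow> (\<forall>i<n. c i = 0))"

lemma independentD:
  "independent b n \<Longrightarrow> (\<And>i. i < n \<Longrightarrow> c i \<in> K) \<Longrightarrow> (\<Sum>i<n. c i * b i) = 0 \<Longrightarrow> i < n \<Longrightarrow> c i = 0"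
  unfolding independent_def by blast

text \<open>Greedy choice: the span of \<open>j\<close> vectors over \<open>K\<close> has at most
  \<open>card K ^ j\<close> elements, so it cannot contain \<open>V\<close>.\<close>

lemma ex_independent:
  assumes "finite K" and "\<And>j. j < n \<Longrightarrow> card K ^ j < card V"
  shows "\<exists>b. (\<forall>i<n. b i \<in> V) \<and> independent b n"
  using assms(2)
proof (induction n)
  case 0
  then show ?case by (auto simp: independent_def)
next
  case (Suc n)
  then obtain b where b: "\<forall>i<n. b i \<in> V" "independent b n"
    by fastforce
  define W where "W = (\<lambda>c. \<Sum>i<n. c i * b i) ` (Pi\<^sub>E {..<n} (\<lambda>_. K))"
  have fin: "finite (Pi\<^sub>E {..<n} (\<lambda>_. K))"
    using assms(1) by (intro finite_PiE) auto
  have "card W \<le> card K ^ n"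
    unfolding W_def using card_image_le[OF fin] by (simp add: card_PiE)
  also have "\<dots> < card V" using Suc.prems by simp
  finally have "\<not> V \<subseteq> W"
    using card_mono[of W V] fin by (auto simp: W_def)
  then obtain v where v: "v \<in> V" "v \<notin> W" by auto
  have "independent (b(n := v)) (Suc n)"
    unfolding independent_def
  proof (intro allI impI)
    fix c i
    assume c: "\<forall>i<Suc n. c i \<in> K" and eq: "(\<Sum>i<Suc n. c i * (b(n := v)) i) = 0" and i: "i < Suc n"
    have eq': "(\<Sum>i<n. c i * b i) + c n * v = 0"
      using eq by simp
    have cn: "c n = 0"
    proof (rule ccontr)
      assume nz: "c n \<noteq> 0"
      \<comment> \<open>Solving the relation for \<open>v\<close> would put \<open>v\<close> in the
        span \<open>W\<close>; \<open>restrict\<close> makes the coefficients an element of the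
        extensional function space.\<close>
      define d where "d = restrict (\<lambda>i. - (c i / c n)) {..<n}"
      have "d \<in> Pi\<^sub>E {..<n} (\<lambda>_. K)"
        using c by (auto simp: d_def intro!: uminus divide)
      moreover have "(\<Sum>i<n. d i * b i) = v"
      proof -
        have "(\<Sum>i<n. d i * b i) = - (\<Sum>i<n. c i * b i) / c n"
          by (simp add: d_def sum_negf sum_divide_distrib)
        also have "\<dots> = v"
          using eq' nz by (simp add: field_simps add_eq_0_iff)
        finally show ?thesis .
      qed
      ultimately have "v \<in> W" unfolding W_def by force
      with v show False by simp
    qed
    then have "\<forall>i<n. c i = 0"
      using b(2) c eq' unfolding independent_def by simp
    with cn i show "c i = 0" by (cases "i = n") auto
  qed
  moreover have "\<forall>i<Suc n. (b(n := v)) i \<in> V"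
    using b(1) v by auto
  ultimately show ?case by blast
qed

end

section \<open>The prime field and the fixed field of a Frobenius power\<close>

lemma subfield_set_prime_char2: "(2::'a::field) = 0 \<Longrightarrow> subfield_set {0, 1::'a}"
  by unfold_locales (auto simp: char2_minus)

lemma subfield_set_frobenius_fixed:
  assumes two: "(2::'a::field) = 0"
  shows "subfield_set {x::'a. x ^ (2 ^ r) = x}"
  by unfold_locales
    (auto simp: char2_add_power[OF two] char2_minus[OF two] power_mult_distrib power_inverse)

text \<open>Both inequalities count polynomial roots: fixed elements are roots of
  \<open>X ^ q - X\<close>, all others are roots of a complementary factor.\<close>

lemma card_frobenius_fixed:
  assumes card: "card (UNIV :: 'a::{finite,field} set) = 2 ^ (r * n)" and "0 < r" "0 < n"
  shows "card {x::'a. x ^ (2 ^ r) = x} = 2 ^ r"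
proof (rule antisym)
  define q :: nat where "q = 2 ^ r"
  have q: "q \<ge> 2" using \<open>0 < r\<close> unfolding q_def by (cases r) auto
  have cardq: "card (UNIV :: 'a set) = q ^ n"
    using card by (simp add: q_def power_mult)
  show "card {x::'a. x ^ (2 ^ r) = x} \<le> 2 ^ r"
  proof -
    define p :: "'a poly" where "p = monom 1 q - monom 1 1"
    have "coeff p q = 1" using q by (simp add: p_def)
    then have "p \<noteq> 0" by auto
    have "degree p \<le> q"
      unfolding p_def using q by (intro degree_diff_le) (auto simp: degree_monom_eq)
    moreover have "{x::'a. x ^ (2 ^ r) = x} = {x. poly p x = 0}"
      by (auto simp: p_def poly_monom q_def)
    ultimately show ?thesis
      using card_poly_roots_bound[OF \<open>p \<noteq> 0\<close>] by (simp add: q_def)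
  qed
  \<comment> \<open>Every nonzero \<open>x\<close> outside the fixed set is a root of
    \<open>(X ^ (q ^ n - 1) - 1) / (X ^ (q - 1) - 1)\<close>, of degree \<open>q ^ n - q\<close>.\<close>
  show "2 ^ r \<le> card {x::'a. x ^ (2 ^ r) = x}"
  proof -
    have "(q - 1) dvd (q ^ n - 1)"
    proof (induction n)
      case (Suc n)
      have "q ^ Suc n - 1 = q * (q ^ n - 1) + (q - 1)"
        using q by (simp add: diff_mult_distrib2)
      then show ?case using Suc by (metis dvd_add dvd_mult dvd_refl)
    qed simp
    then obtain N where N: "q ^ n - 1 = (q - 1) * N" by auto
    have qn: "q ^ n > 1" using q \<open>0 < n\<close> by (intro one_less_power) auto
    then have "N > 0" using N by (cases N) auto
    define p :: "'a poly" where "p = (\<Sum>i<N. monom 1 ((q - 1) * i))"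
    \<comment> \<open>Only the term with index \<open>N - 1\<close> has this degree, so
      \<open>p\<close> is not the zero polynomial.\<close>
    have "coeff p ((q - 1) * (N - 1)) = (\<Sum>i<N. if i = N - 1 then 1 else 0)"
      unfolding p_def coeff_sum using q by (intro sum.cong) auto
    also have "\<dots> = 1" using \<open>N > 0\<close> by simp
    finally have "p \<noteq> 0" by auto
    have deg: "degree p \<le> (q - 1) * (N - 1)"
      unfolding p_def by (intro degree_sum_le) (auto simp: degree_monom_eq)
    have "(q - 1) * (N - 1) = (q - 1) * N - (q - 1)"
      by (simp add: diff_mult_distrib2)
    also have "\<dots> = q ^ n - q"
      unfolding N[symmetric] using q by simp
    finally have roots: "card {x. poly p x = 0} \<le> q ^ n - q"
      using card_poly_roots_bound[OF \<open>p \<noteq> 0\<close>] deg by simp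
    have "UNIV \<subseteq> {x::'a. x ^ q = x} \<union> {x. poly p x = 0}"
    proof
      fix x :: 'a
      show "x \<in> {x::'a. x ^ q = x} \<union> {x. poly p x = 0}"
      \<comment> \<open>Summing the geometric progression requires \<open>x ^ (q - 1)\<close> to
        differ from 1; the excluded \<open>x\<close> are fixed by the \<open>q\<close>-th
        power.\<close>
      proof (cases "x = 0 \<or> x ^ (q - 1) = 1")
        case True
        then have "x ^ q = x"
          using q by (metis power_eq_if mult.right_neutral mult_zero_left not_numeral_le_zero)
        then show ?thesis by simp
      next
        case False
        have "x * x ^ (q ^ n - 1) = x"
          using power_card_UNIV_eq[of x] qn cardq by (metis power_eq_if not_less_zero)
        then have "(x ^ (q - 1)) ^ N = 1"
          using False unfolding N by (simp add: power_mult)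
        moreover have "poly p x = (\<Sum>i<N. (x ^ (q - 1)) ^ i)"
          by (simp add: p_def poly_sum poly_monom power_mult)
        ultimately have "poly p x = 0"
          using False by (simp add: geometric_sum)
        then show ?thesis by simp
      qed
    qed
    then have "q ^ n \<le> card ({x::'a. x ^ q = x} \<union> {x. poly p x = 0})"
      using cardq by (metis card_mono finite)
    also have "\<dots> \<le> card {x::'a. x ^ q = x} + (q ^ n - q)"
      using card_Un_le roots by (meson add_left_mono order_trans)
    finally have "q ^ n \<le> card {x::'a. x ^ q = x} + (q ^ n - q)" .
    moreover have "q \<le> q ^ n"
      using q \<open>0 < n\<close> by (simp add: self_le_power)
    ultimately show ?thesis unfolding q_def by linarith
  qed
qed

section \<open>A product of elliptic quadrics\<close>

definition quad_form :: "'a::field \<Rightarrow> 'a \<Rightarrow> 'a \<Rightarrow> 'a" where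
  "quad_form c x y = x\<^sup>2 + x * y + c * y\<^sup>2"

text \<open>The map sending \<open>x\<close> to \<open>x\<^sup>2 + x\<close> takes 0 and 1 to the
  same value, hence misses some \<open>c\<close> in the finite set \<open>K\<close>. A zero of the
  form with \<open>y\<close> nonzero would, after division by \<open>y\<^sup>2\<close>, put
  \<open>c\<close> in the image.\<close>

lemma (in subfield_set) ex_anisotropic:
  assumes two: "(2::'a) = 0" and "finite K"
  shows "\<exists>c\<in>K. \<forall>x\<in>K. \<forall>y\<in>K. quad_form c x y = 0 \<longrightarrow> x = 0 \<and> y = 0"
proof -
  have sub: "(\<lambda>x. x\<^sup>2 + x) ` K \<subseteq> K"
    by (auto simp: power2_eq_square intro!: add mult)
  have "\<not> inj_on (\<lambda>x. x\<^sup>2 + x) K"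
    using zero one two inj_onD[of "\<lambda>x. x\<^sup>2 + x" K 0 1] by auto
  then have "(\<lambda>x. x\<^sup>2 + x) ` K \<noteq> K"
    using \<open>finite K\<close> by (metis eq_card_imp_inj_on)
  then obtain c where c: "c \<in> K" "\<And>x. x \<in> K \<Longrightarrow> x\<^sup>2 + x \<noteq> c"
    using sub by blast
  have "x = 0 \<and> y = 0" if "x \<in> K" "y \<in> K" and eq: "quad_form c x y = 0" for x y
  proof (cases "y = 0")
    case True
    then show ?thesis using eq by (simp add: quad_form_def)
  next
    case False
    have "(x / y)\<^sup>2 + x / y + c = quad_form c x y / y\<^sup>2"
      using False by (simp add: quad_form_def field_simps power2_eq_square)
    then have "(x / y)\<^sup>2 + x / y + c = 0" using eq by simp
    then have "(x / y)\<^sup>2 + x / y = c"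
      using char2_minus[OF two, of c] by (simp add: eq_neg_iff_add_eq_0 [symmetric])
    then show ?thesis using c(2) divide that by blast
  qed
  with c(1) show ?thesis by blast
qed

text \<open>Translating to the third point, \<open>a (x\<^sub>1 - x\<^sub>3) = - b (x\<^sub>2 - x\<^sub>3)\<close>, and likewise for \<open>y\<close>; comparing
  the values of the form leaves \<open>b d N(x\<^sub>2 - x\<^sub>3, y\<^sub>2 - y\<^sub>3) = 0\<close>.\<close>
lemma (in subfield_set) elliptic_cap:
  assumes aniso: "\<And>x y. x \<in> K \<Longrightarrow> y \<in> K \<Longrightarrow> quad_form c x y = 0 \<Longrightarrow> x = 0 \<and> y = 0"
    and K: "x2 \<in> K" "y2 \<in> K" "x3 \<in> K" "y3 \<in> K"
    and nz: "b \<noteq> 0" "d \<noteq> 0"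
    and eqs: "a + b + d = 0" "a * x1 + b * x2 + d * x3 = 0" "a * y1 + b * y2 + d * y3 = 0"
      "a * quad_form c x1 y1 + b * quad_form c x2 y2 + d * quad_form c x3 y3 = 0"
  shows "x2 = x3 \<and> y2 = y3"
proof -
  have "b * d * quad_form c (x2 - x3) (y2 - y3) = 0"
    using eqs unfolding quad_form_def by algebra
  then have "quad_form c (x2 - x3) (y2 - y3) = 0" using nz by simp
  moreover have "x2 - x3 \<in> K" "y2 - y3 \<in> K"
    using K add uminus by (metis diff_conv_add_uminus)+
  ultimately show ?thesis using aniso by fastforce
qed

text \<open>The point of the affine cap with parameter \<open>v\<close>, in homogeneous coordinates: a leading \<open>1\<close>,
  followed by one triple \<open>(x, y, N(x, y))\<close> for each pair of entries of \<open>v\<close>.\<close>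
definition cap_coord :: "'a::field \<Rightarrow> (nat \<Rightarrow> 'a) \<Rightarrow> nat \<Rightarrow> 'a" where
  "cap_coord c v j =
    (if j = 0 then 1
     else let i = (j - 1) div 3; x = v (2 * i); y = v (2 * i + 1) in
       if (j - 1) mod 3 = 0 then x else if (j - 1) mod 3 = 1 then y else quad_form c x y)"

lemma cap_coord_simps:
  "cap_coord c v 0 = 1"
  "cap_coord c v (3 * i + 1) = v (2 * i)"
  "cap_coord c v (3 * i + 2) = v (2 * i + 1)"
  "cap_coord c v (3 * i + 3) = quad_form c (v (2 * i)) (v (2 * i + 1))"
proof -
  show "cap_coord c v 0 = 1" by (simp add: cap_coord_def)
  show "cap_coord c v (3 * i + 1) = v (2 * i)" by (simp add: cap_coord_def)
  have "3 * i + 2 - 1 = 1 + i * 3" by simp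
  moreover have "(1 + i * 3) div 3 = i" "(1 + i * 3) mod 3 = 1"
    by (simp_all only: div_mult_self1 mod_mult_self1) simp_all
  ultimately show "cap_coord c v (3 * i + 2) = v (2 * i + 1)" by (simp add: cap_coord_def Let_def mult.commute)
  have "3 * i + 3 - 1 = 2 + i * 3" by simp
  moreover have "(2 + i * 3) div 3 = i" "(2 + i * 3) mod 3 = 2"
    by (simp_all only: div_mult_self1 mod_mult_self1) simp_all
  ultimately show "cap_coord c v (3 * i + 3) = quad_form c (v (2 * i)) (v (2 * i + 1))"
    by (simp add: cap_coord_def Let_def mult.commute)
qed

lemma card_le_3_cases:
  assumes "finite A" "A \<noteq> {}" "card A \<le> 3"
  obtains x where "A = {x}" | x y where "A = {x, y}" "x \<noteq> y"
  | x y z where "A = {x, y, z}" "x \<noteq> y" "x \<noteq> z" "y \<noteq> z"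
proof -
  have "card A = 1 \<or> card A = 2 \<or> card A = 3"
    using assms by (metis card_0_eq le_Suc_eq le_zero_eq numeral_2_eq_2 numeral_3_eq_3 One_nat_def)
  then show ?thesis
    using that by (metis card_1_singletonE card_2_iff card_3_iff)
qed

context subfield_set
begin

lemma cap_coord_in: "c \<in> K \<Longrightarrow> (\<And>i. i < 2 * s \<Longrightarrow> v i \<in> K) \<Longrightarrow> j < 3 * s + 1 \<Longrightarrow> cap_coord c v j \<in> K"
proof -
  assume c: "c \<in> K" and v: "\<And>i. i < 2 * s \<Longrightarrow> v i \<in> K" and j: "j < 3 * s + 1"
  show ?thesis
  proof (cases "j = 0")
    case False
    then have "2 * ((j - 1) div 3) + 1 < 2 * s" using j by presburger
    then have "v (2 * ((j - 1) div 3)) \<in> K" "v (2 * ((j - 1) div 3) + 1) \<in> K"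
      using v by simp_all
    then show ?thesis
      using c False by (simp add: cap_coord_def Let_def quad_form_def power2_eq_square add mult)
  qed (simp add: cap_coord_def one)
qed

text \<open>Independence of \<open>b\<close> splits a relation among the \<open>P g\<close> into its
  homogeneous coordinates: a leading one and \<open>s\<close> triples. Injectivity of the parameter
  vectors, available because there are \<open>card K ^ (2 * s)\<close> of them, turns equality in
  all pairs of entries into equality of groups.\<close>

lemma ex_three_independent_points:
  assumes two: "(2::'a) = 0" and fin: "finite K" and b: "independent b (3 * s + 1)"
    and l: "l \<le> card K ^ (2 * s)"
  shows "\<exists>P. \<forall>G \<kappa>. G \<subseteq> {..<l} \<and> G \<noteq> {} \<and> card G \<le> 3 \<and> (\<forall>g\<in>G. \<kappa> g \<in> K \<and> \<kappa> g \<noteq> 0) \<longrightarrow>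
           (\<Sum>g\<in>G. \<kappa> g * P g) \<noteq> 0"
proof -
  obtain c where c: "c \<in> K" and
    aniso: "\<And>x y. x \<in> K \<Longrightarrow> y \<in> K \<Longrightarrow> quad_form c x y = 0 \<Longrightarrow> x = 0 \<and> y = 0"
    using ex_anisotropic[OF two fin] by blast
  have "finite (Pi\<^sub>E {..<2 * s} (\<lambda>_. K))"
    using fin by (intro finite_PiE) auto
  then have "\<exists>v. v ` {..<l} \<subseteq> Pi\<^sub>E {..<2 * s} (\<lambda>_. K) \<and> inj_on v {..<l}"
    using l by (intro card_le_inj) (auto simp: card_PiE)
  then obtain v where v: "\<And>g. g < l \<Longrightarrow> v g \<in> Pi\<^sub>E {..<2 * s} (\<lambda>_. K)" and inj: "inj_on v {..<l}"
    by blast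
  have vK: "v g i \<in> K" if "g < l" "i < 2 * s" for g i
    using v[of g] that by auto
  have distinct: "g = g'"
    if g: "g < l" "g' < l" and eq: "\<And>i. i < s \<Longrightarrow> v g (2 * i) = v g' (2 * i) \<and> v g (2 * i + 1) = v g' (2 * i + 1)"
    for g g'
  proof -
    have "v g i = v g' i" if "i < 2 * s" for i
    proof (cases "even i")
      case True
      then obtain j where "i = 2 * j" by (elim evenE)
      then show ?thesis using eq[of j] that by simp
    next
      case False
      then obtain j where "i = 2 * j + 1" by (elim oddE)
      then show ?thesis using eq[of j] that by simp
    qed
    then have "v g = v g'"
      using v[of g] v[of g'] g by (intro PiE_ext[of "v g" "{..<2 * s}" "\<lambda>_. K"]) auto
    then show ?thesis using inj g by (auto simp: inj_on_def)
  qed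
  define P where "P g = (\<Sum>j<3 * s + 1. cap_coord c (v g) j * b j)" for g
  have "(\<Sum>g\<in>G. \<kappa> g * P g) \<noteq> 0"
    if G: "G \<subseteq> {..<l}" "G \<noteq> {}" "card G \<le> 3" and \<kappa>: "\<forall>g\<in>G. \<kappa> g \<in> K \<and> \<kappa> g \<noteq> 0" for G \<kappa>
  proof
    assume eq: "(\<Sum>g\<in>G. \<kappa> g * P g) = 0"
    have "(\<Sum>g\<in>G. \<kappa> g * P g) = (\<Sum>j<3 * s + 1. (\<Sum>g\<in>G. \<kappa> g * cap_coord c (v g) j) * b j)"
      unfolding P_def sum_distrib_left sum_distrib_right
      by (subst sum.swap) (simp add: mult.assoc)
    moreover have "\<forall>j<3 * s + 1. (\<Sum>g\<in>G. \<kappa> g * cap_coord c (v g) j) \<in> K"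
      using G(1) \<kappa> by (intro allI impI sum mult cap_coord_in[where s = s]) (auto intro: vK c)
    ultimately have coef: "(\<Sum>g\<in>G. \<kappa> g * cap_coord c (v g) j) = 0" if "j < 3 * s + 1" for j
      using eq that
      by (intro independentD[OF b, where c = "\<lambda>j. \<Sum>g\<in>G. \<kappa> g * cap_coord c (v g) j"]) auto
    have coef0: "(\<Sum>g\<in>G. \<kappa> g) = 0"
      using coef[of 0] by (simp add: cap_coord_simps)
    have coefs: "(\<Sum>g\<in>G. \<kappa> g * v g (2 * i)) = 0" "(\<Sum>g\<in>G. \<kappa> g * v g (2 * i + 1)) = 0"
      "(\<Sum>g\<in>G. \<kappa> g * quad_form c (v g (2 * i)) (v g (2 * i + 1))) = 0" if "i < s" for i
      using coef[of "3 * i + 1"] coef[of "3 * i + 2"] coef[of "3 * i + 3"] that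
      by (simp_all only: cap_coord_simps)
    have "finite G" using G(1) finite_subset by blast
    then show False using G(2,3)
    proof (cases rule: card_le_3_cases)
      case (1 g)
      then show False using coef0 \<kappa> by simp
    next
      case (2 g g')
      then have k: "\<kappa> g + \<kappa> g' = 0" using coef0 by simp
      have cancel: "x = y" if "\<kappa> g * x + \<kappa> g' * y = 0" for x y
      proof -
        have "\<kappa> g * (x - y) = 0" using k that by algebra
        then show ?thesis using \<kappa> 2 by simp
      qed
      have "v g (2 * i) = v g' (2 * i) \<and> v g (2 * i + 1) = v g' (2 * i + 1)" if "i < s" for i
        using coefs(1,2)[OF that] 2 by (auto intro: cancel)
      then have "g = g'" using G(1) 2 by (intro distinct) auto
      then show False using 2 by simp
    next
      case (3 g1 g2 g3)
      \<comment> \<open>The same coefficients occur in every factor of the product, so the quadric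
        argument makes the second and third points agree in each pair.\<close>
      have "v g2 (2 * i) = v g3 (2 * i) \<and> v g2 (2 * i + 1) = v g3 (2 * i + 1)" if "i < s" for i
      proof (rule elliptic_cap[of c _ _ _ _ "\<kappa> g2" "\<kappa> g3" "\<kappa> g1" "v g1 (2 * i)" "v g1 (2 * i + 1)"])
        show "\<And>x y. x \<in> K \<Longrightarrow> y \<in> K \<Longrightarrow> quad_form c x y = 0 \<Longrightarrow> x = 0 \<and> y = 0" by (rule aniso)
        show "v g2 (2 * i) \<in> K" "v g2 (2 * i + 1) \<in> K" "v g3 (2 * i) \<in> K" "v g3 (2 * i + 1) \<in> K"
          using 3 G(1) that by (auto intro!: vK)
        show "\<kappa> g2 \<noteq> 0" "\<kappa> g3 \<noteq> 0" using 3 \<kappa> by auto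
      qed (use 3 coef0 coefs[OF that] in \<open>simp_all add: add.assoc\<close>)
      then have "g2 = g3" using G(1) 3 by (intro distinct) auto
      then show False using 3 by simp
    qed
  qed
  then show ?thesis by blast
qed

end

section \<open>The coefficients of the parity checks\<close>

text \<open>Take \<open>r\<close> elements independent over the prime field and append 0 at index
  \<open>r\<close>, the index of the local parity. An index set with at least two elements contains
  an index below \<open>r\<close>, so its sum is a nontrivial combination.\<close>

lemma ex_affinely_independent_in_subset:
  assumes two: "(2::'a::field) = 0" and card: "2 ^ r \<le> card K"
  shows "\<exists>\<gamma> :: nat \<Rightarrow> 'a. \<gamma> r = 0 \<and> (\<forall>i<r. \<gamma> i \<in> K) \<and> (\<forall>A\<subseteq>{..r}. 2 \<le> card A \<longrightarrow> sum \<gamma> A \<noteq> 0)"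
proof -
  interpret F2: subfield_set "{0, 1::'a}" by (rule subfield_set_prime_char2[OF two])
  have "card {0, 1::'a} ^ j < card K" if "j < r" for j
  proof -
    have "(2::nat) ^ j < 2 ^ r" using that by simp
    also note card
    finally show ?thesis by (simp add: numeral_2_eq_2 [symmetric])
  qed
  then obtain b where b: "\<forall>i<r. b i \<in> K" "F2.independent b r"
    using F2.ex_independent[of r K] by auto
  define \<gamma> where "\<gamma> = b(r := 0)"
  have "sum \<gamma> A \<noteq> 0" if A: "A \<subseteq> {..r}" "2 \<le> card A" for A
  proof
    assume 0: "sum \<gamma> A = 0"
    have finA: "finite A" using A(1) finite_subset by blast
    have "sum \<gamma> A = (\<Sum>i\<in>A - {r}. b i)"
      using finA by (intro sum.mono_neutral_cong_right) (auto simp: \<gamma>_def)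
    also have "\<dots> = (\<Sum>i<r. (if i \<in> A then 1 else 0) * b i)"
      using A(1) by (intro sum.mono_neutral_cong_left) auto
    finally have ind: "(if i \<in> A then 1 else 0) = (0::'a)" if "i < r" for i
      using 0 that
      by (intro F2.independentD[OF b(2), where c = "\<lambda>i. if i \<in> A then 1 else 0"]) auto
    have "i \<notin> A" if "i < r" for i
      using ind[OF that] by (auto split: if_splits)
    then have "A \<subseteq> {r}" using A(1) by (auto simp: le_less)
    then show False using A(2) card_mono[of "{r}" A] by simp
  qed
  moreover have "\<gamma> r = 0" "\<forall>i<r. \<gamma> i \<in> K"
    using b(1) by (simp_all add: \<gamma>_def)
  ultimately show ?thesis by blast
qed

text \<open>Row \<open>g\<close> lists the coefficients of the symbols of group \<open>g\<close>; index \<open>r\<close> stands for the local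
  parity, which does not enter the heavy checks. In the sum, \<open>e g\<close> is the erased symbol of group
  \<open>g\<close>, which has been eliminated with the help of the local check.\<close>
lemma ex_check_coefficients:
  assumes card: "card (UNIV :: 'a::{finite,field} set) = 2 ^ (r * (3 * s + 1))" and r: "0 < r"
    and l: "l \<le> 2 ^ (r * (2 * s))"
  shows "\<exists>\<beta> :: nat \<Rightarrow> nat \<Rightarrow> 'a. (\<forall>g. \<beta> g r = 0) \<and>
    (\<forall>U e. U \<subseteq> {..<l} \<times> {..r} \<and> U \<noteq> {} \<and> card U \<le> 3 \<and> (\<forall>(g, i)\<in>U. e g \<le> r \<and> i \<noteq> e g) \<longrightarrow>
       (\<Sum>(g, i)\<in>U. \<beta> g i + \<beta> g (e g)) \<noteq> 0)"
proof -
  have two: "(2::'a) = 0"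
    using card r by (intro two_eq_0_if_card_even) simp
  define K where "K = {x::'a. x ^ (2 ^ r) = x}"
  interpret K: subfield_set K
    unfolding K_def by (rule subfield_set_frobenius_fixed[OF two])
  have cardK: "card K = 2 ^ r"
    unfolding K_def by (rule card_frobenius_fixed[OF card r]) simp
  have "card K ^ j < card (UNIV :: 'a set)" if "j < 3 * s + 1" for j
  proof -
    have "r * j < r * (3 * s + 1)" using that r by (intro mult_strict_left_mono)
    then show ?thesis by (simp only: cardK card power_mult [symmetric]) simp
  qed
  then obtain b where b: "K.independent b (3 * s + 1)"
    using K.ex_independent[of "3 * s + 1" UNIV] by auto
  have "l \<le> card K ^ (2 * s)"
    using l by (simp only: cardK power_mult [symmetric])
  from K.ex_three_independent_points[OF two finite b this]
  obtain P where P': "\<forall>G \<kappa>. G \<subseteq> {..<l} \<and> G \<noteq> {} \<and> card G \<le> 3 \<and>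
      (\<forall>g\<in>G. \<kappa> g \<in> K \<and> \<kappa> g \<noteq> 0) \<longrightarrow> (\<Sum>g\<in>G. \<kappa> g * P g) \<noteq> 0"
    by (elim exE)
  have P: "(\<Sum>g\<in>G. \<kappa> g * P g) \<noteq> 0"
    if "G \<subseteq> {..<l}" "G \<noteq> {}" "card G \<le> 3" "\<And>g. g \<in> G \<Longrightarrow> \<kappa> g \<in> K \<and> \<kappa> g \<noteq> 0" for G \<kappa>
    using that by (intro P'[rule_format]) simp
  obtain \<gamma> :: "nat \<Rightarrow> 'a" where \<gamma>: "\<gamma> r = 0" "\<forall>i<r. \<gamma> i \<in> K"
    "\<And>A. A \<subseteq> {..r} \<Longrightarrow> 2 \<le> card A \<Longrightarrow> sum \<gamma> A \<noteq> 0"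
    using ex_affinely_independent_in_subset[OF two, of r K] cardK by auto
  have \<gamma>K: "\<gamma> i \<in> K" if "i \<le> r" for i
    using that \<gamma>(1,2) K.zero by (cases "i = r") auto
  \<comment> \<open>Only the parity of \<open>card A\<close> matters: the copies of
    \<gamma>\<open>j\<close> cancel if it is even and leave one if it is odd. Either way the result
    is a sum of \<gamma> over at least two indices.\<close>
  have diff: "(\<Sum>i\<in>A. \<gamma> i + \<gamma> j) \<noteq> 0" if A: "A \<subseteq> {..r}" "A \<noteq> {}" "j \<le> r" "j \<notin> A" for A j
  proof -
    have finA: "finite A" using A(1) finite_subset by blast
    then have pos: "card A > 0" using A(2) by (simp add: card_gt_0_iff)
    have eq: "(\<Sum>i\<in>A. \<gamma> i + \<gamma> j) = sum \<gamma> A + of_nat (card A) * \<gamma> j"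
      by (simp add: sum.distrib)
    show ?thesis
    proof (cases "even (card A)")
      case True
      then have "of_nat (card A) = (0::'a)" using two by (auto elim!: evenE)
      then show ?thesis using eq \<gamma>(3)[OF A(1)] True pos by (auto elim!: evenE)
    next
      case False
      then have "of_nat (card A) = (1::'a)" using two by (auto elim!: oddE)
      then have "(\<Sum>i\<in>A. \<gamma> i + \<gamma> j) = sum \<gamma> (insert j A)"
        using eq finA A(4) by (simp add: add.commute)
      then show ?thesis using \<gamma>(3)[of "insert j A"] A finA pos by auto
    qed
  qed
  define \<beta> where "\<beta> g i = \<gamma> i * P g" for g i
  have "(\<Sum>(g, i)\<in>U. \<beta> g i + \<beta> g (e g)) \<noteq> 0"
    if U: "U \<subseteq> {..<l} \<times> {..r}" "U \<noteq> {}" "card U \<le> 3" "\<forall>(g, i)\<in>U. e g \<le> r \<and> i \<noteq> e g" for U e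
  proof -
    have finU: "finite U" using U(1) by (rule finite_subset) simp
    \<comment> \<open>Grouping by rows turns the sum into a relation among at most three
      \<open>P g\<close>, whose coefficients lie in \<open>K\<close> and are nonzero by
      \<open>diff\<close>.\<close>
    define \<kappa> where "\<kappa> g = (\<Sum>i\<in>U `` {g}. \<gamma> i + \<gamma> (e g))" for g
    have UD: "U = Sigma (fst ` U) (\<lambda>g. U `` {g})" by force
    have finUg: "finite (U `` {g})" for g
      using finU by (rule finite_Image)
    have "(\<Sum>(g, i)\<in>U. \<beta> g i + \<beta> g (e g)) = (\<Sum>g\<in>fst ` U. \<Sum>i\<in>U `` {g}. \<beta> g i + \<beta> g (e g))"
      by (subst UD, subst sum.Sigma) (use finU finUg in auto)
    also have "\<dots> = (\<Sum>g\<in>fst ` U. \<kappa> g * P g)"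
      by (simp add: \<beta>_def \<kappa>_def sum_distrib_right distrib_right)
    also have "\<dots> \<noteq> 0"
    proof (rule P)
      show "card (fst ` U) \<le> 3" using card_image_le[OF finU, of fst] U(3) by linarith
      fix g assume "g \<in> fst ` U"
      then obtain i where i: "(g, i) \<in> U" by auto
      have sub: "U `` {g} \<subseteq> {..r}" using U(1) by auto
      show "\<kappa> g \<in> K \<and> \<kappa> g \<noteq> 0"
      proof
        show "\<kappa> g \<in> K" unfolding \<kappa>_def
          using sub U(4) i by (intro K.sum K.add \<gamma>K) auto
        show "\<kappa> g \<noteq> 0" unfolding \<kappa>_def
          using U(4) i by (intro diff sub) auto
      qed
    qed (use U in auto)
    finally show ?thesis .
  qed
  moreover have "\<forall>g. \<beta> g r = 0"
    by (simp add: \<beta>_def \<gamma>(1))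
  ultimately show ?thesis by blast
qed

section \<open>Erasure correction\<close>

text \<open>The subset sums that contain \<open>i\<close> are the factors in
  \<open>moore3_first_eq_0\<close>; a system with two columns is padded with a zero column.\<close>

lemma moore_kernel_trivial:
  fixes \<delta> y :: "nat \<Rightarrow> 'a::field"
  assumes two: "(2::'a) = 0" and T: "finite T" "card T \<le> 3"
    and nz: "\<And>U. U \<subseteq> T \<Longrightarrow> U \<noteq> {} \<Longrightarrow> sum \<delta> U \<noteq> 0"
    and eq: "\<And>j. j < 3 \<Longrightarrow> (\<Sum>i\<in>T. \<delta> i ^ (2 ^ j) * y i) = 0"
    and i: "i \<in> T"
  shows "y i = 0"
proof -
  have eqs: "(\<Sum>i\<in>T. \<delta> i * y i) = 0" "(\<Sum>i\<in>T. (\<delta> i)\<^sup>2 * y i) = 0" "(\<Sum>i\<in>T. \<delta> i ^ 4 * y i) = 0"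
    using eq[of 0] eq[of 1] eq[of 2] by simp_all
  have Ti: "T = insert i (T - {i})" using i by auto
  have "card (T - {i}) = 0 \<or> card (T - {i}) = 1 \<or> card (T - {i}) = 2"
    using T i by (simp add: card_Diff_singleton) linarith
  then consider "T = {i}" | p where "T = {i, p}" "p \<noteq> i"
    | p q where "T = {i, p, q}" "p \<noteq> i" "q \<noteq> i" "p \<noteq> q"
  proof (elim disjE)
    assume "card (T - {i}) = 0"
    then have "T - {i} = {}" using T(1) by simp
    then have "T = {i}" using i by auto
    then show thesis by (rule that(1))
  next
    assume "card (T - {i}) = 1"
    then obtain p where "T - {i} = {p}" by (rule card_1_singletonE)
    then show thesis using Ti by (intro that(2)[of p]) auto
  next
    assume "card (T - {i}) = 2"
    then obtain p q where "T - {i} = {p, q}" "p \<noteq> q" by (auto simp: card_2_iff)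
    then show thesis using Ti by (intro that(3)[of p q]) auto
  qed
  then show ?thesis
  proof cases
    case 1
    then show ?thesis using eqs(1) nz[of "{i}"] by simp
  next
    case (2 p)
    show ?thesis
      by (rule moore3_first_eq_0[OF two, of "\<delta> i" "\<delta> p" 0 _ "y p" 0])
        (use 2 eqs nz[of "{i}"] nz[of "{i, p}"] in auto)
  next
    case (3 p q)
    show ?thesis
      by (rule moore3_first_eq_0[OF two, of "\<delta> i" "\<delta> p" "\<delta> q" _ "y p" "y q"])
        (use 3 eqs nz[of "{i}"] nz[of "{i, p}"] nz[of "{i, q}"] nz[of "{i, p, q}"]
          in \<open>auto simp: add.assoc\<close>)
  qed
qed

text \<open>By pigeonhole some nonzero word vanishes on \<open>k - 1\<close> prescribed coordinates, so the minimum
  distance cannot exceed \<open>h + 1\<close> (Singleton bound).\<close>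
lemma is_MDS_code_range:
  fixes enc :: "(nat \<Rightarrow> 'a::{finite,field}) \<Rightarrow> nat \<Rightarrow> 'a"
  assumes k: "0 < k" and S: "finite S" "card S = k + h"
    and diff: "\<And>x y. enc (\<lambda>i. x i - y i) = (\<lambda>i. enc x i - enc y i)"
    and local: "\<And>x y. (\<And>i. i < k \<Longrightarrow> x i = y i) \<Longrightarrow> enc x = enc y"
    and weight: "\<And>x j. j < k \<Longrightarrow> x j \<noteq> 0 \<Longrightarrow> h + 1 \<le> weight_on S (enc x)"
  shows "is_MDS_code S (range enc) (k + h) k"
proof -
  \<comment> \<open>Messages are functions on all naturals; \<open>X\<close> is a finite set of
    representatives determined by the first \<open>k\<close> entries.\<close>
  define X where "X = Pi\<^sub>E {..<k} (\<lambda>_. UNIV :: 'a set)"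
  have cardX: "card X = card (UNIV :: 'a set) ^ k"
    unfolding X_def by (simp add: card_PiE)
  have enc0: "enc (\<lambda>_. 0) = (\<lambda>_. 0)"
    using diff[of "\<lambda>_. 0" "\<lambda>_. 0"] by simp
  have wz: "h + 1 \<le> weight_on S (\<lambda>i. enc x i - enc y i)" if "x \<in> X" "y \<in> X" "x \<noteq> y" for x y
  proof -
    have "\<exists>j<k. x j \<noteq> y j"
      using that PiE_ext[of x "{..<k}" "\<lambda>_. UNIV" y] unfolding X_def by auto
    then obtain j where "j < k" "x j - y j \<noteq> 0" by auto
    then have "h + 1 \<le> weight_on S (enc (\<lambda>i. x i - y i))" by (rule weight)
    then show ?thesis by (simp add: diff)
  qed
  have "range enc = enc ` X"
  proof
    show "range enc \<subseteq> enc ` X"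
    proof
      fix w assume "w \<in> range enc"
      then obtain x where "w = enc x" by auto
      also have "enc x = enc (restrict x {..<k})" by (rule local) simp
      finally show "w \<in> enc ` X" unfolding X_def by auto
    qed
  qed auto
  moreover have "inj_on enc X"
  proof (rule inj_onI, rule ccontr)
    fix x y assume "x \<in> X" "y \<in> X" "enc x = enc y" "x \<noteq> y"
    then show False using wz[of x y] by (simp add: weight_on_def)
  qed
  ultimately have card: "card (range enc) = card (UNIV :: 'a set) ^ k"
    by (simp add: card_image cardX)
  have "min_distance S (range enc) = h + 1"
    unfolding min_distance_def
  proof (rule Min_eqI)
    have "weight_on S w \<le> card S" for w :: "nat \<Rightarrow> 'a"
      unfolding weight_on_def using S(1) by (intro card_mono) auto
    then have "{weight_on S w |w. w \<in> range enc \<and> w \<noteq> (\<lambda>_. 0)} \<subseteq> {..card S}" by auto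
    then show "finite {weight_on S w |w. w \<in> range enc \<and> w \<noteq> (\<lambda>_. 0)}"
      by (rule finite_subset) simp
  next
    fix d assume "d \<in> {weight_on S w |w. w \<in> range enc \<and> w \<noteq> (\<lambda>_. 0)}"
    then obtain x where x: "d = weight_on S (enc x)" "enc x \<noteq> (\<lambda>_. 0)" by auto
    have "\<exists>j<k. x j \<noteq> 0"
      using x(2) local[of x "\<lambda>_. 0"] enc0 by auto
    then show "h + 1 \<le> d" using x(1) weight by auto
  next
    obtain R where R: "R \<subseteq> S" "card R = k - 1"
      using obtain_subset_with_card_n[of "k - 1" S] S by (metis diff_le_self le_add1 order_trans)
    have finR: "finite R" using R(1) S(1) finite_subset by blast
    have "card {0, 1::'a} \<le> card (UNIV :: 'a set)" by (intro card_mono) auto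
    then have "1 < card (UNIV :: 'a set)" by simp
    then have "card (UNIV :: 'a set) ^ (k - 1) < card X"
      unfolding cardX using k by (intro power_strict_increasing) auto
    then have "card (Pi\<^sub>E R (\<lambda>_. UNIV :: 'a set)) < card X"
      using finR R(2) by (simp add: card_PiE)
    moreover have "finite (Pi\<^sub>E R (\<lambda>_. UNIV :: 'a set))"
      using finR by (intro finite_PiE) auto
    moreover have "(\<lambda>x. restrict (enc x) R) ` X \<subseteq> Pi\<^sub>E R (\<lambda>_. UNIV)" by auto
    ultimately have "\<not> inj_on (\<lambda>x. restrict (enc x) R) X"
      using card_inj_on_le[of "\<lambda>x. restrict (enc x) R" X "Pi\<^sub>E R (\<lambda>_. UNIV :: 'a set)"] by linarith
    then obtain x y where xy: "x \<in> X" "y \<in> X" "x \<noteq> y" "restrict (enc x) R = restrict (enc y) R"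
      by (auto simp: inj_on_def)
    have agree: "enc x i = enc y i" if "i \<in> R" for i
      using fun_cong[OF xy(4), of i] that by simp
    define w where "w = (\<lambda>i. enc x i - enc y i)"
    have ge: "h + 1 \<le> weight_on S w" unfolding w_def using xy by (intro wz)
    have "weight_on S w \<le> card (S - R)"
      unfolding weight_on_def using S(1) agree by (intro card_mono) (auto simp: w_def)
    also have "\<dots> = h + 1"
      using R S k finR by (simp add: card_Diff_subset)
    finally have "h + 1 = weight_on S w" using ge by simp
    moreover have "w \<in> range enc"
      unfolding w_def diff[symmetric] by simp
    moreover have "w \<noteq> (\<lambda>_. 0)"
      using ge by (auto simp: weight_on_def)
    ultimately show "h + 1 \<in> {weight_on S w |w. w \<in> range enc \<and> w \<noteq> (\<lambda>_. 0)}" by blast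
  qed
  then show ?thesis unfolding is_MDS_code_def using S(2) card by simp
qed

text \<open>Heavy parities are chosen so that the codewords satisfy
  \<open>\<Sum>i<k+3. a i ^ (2 ^ j) * y i = 0\<close> for \<open>j < 3\<close>; this is possible since the Moore matrix of the
  last three coefficients is invertible.\<close>
lemma ex_heavy_coefficients:
  fixes a :: "nat \<Rightarrow> 'a::{finite,field}"
  assumes two: "(2::'a) = 0"
    and nz: "\<And>U. U \<subseteq> {k..<k + 3} \<Longrightarrow> U \<noteq> {} \<Longrightarrow> sum a U \<noteq> 0"
  shows "\<exists>Cf. \<forall>x. \<forall>p<3. (\<Sum>i<k + 3. a i ^ (2 ^ p) * dh_symbol k Cf x i) = 0"
proof -
  define T where "T = {k..<k + 3}"
  have Tset: "T = {k, Suc k, Suc (Suc k)}" by (auto simp: T_def)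
  define \<phi> where "\<phi> = (\<lambda>(u, v, w).
      (a k * u + a (Suc k) * v + a (Suc (Suc k)) * w,
       (a k)\<^sup>2 * u + (a (Suc k))\<^sup>2 * v + (a (Suc (Suc k)))\<^sup>2 * w,
       a k ^ 4 * u + a (Suc k) ^ 4 * v + a (Suc (Suc k)) ^ 4 * w))"
  have "inj \<phi>"
  proof (rule injI)
    fix s s' :: "'a \<times> 'a \<times> 'a"
    assume eq: "\<phi> s = \<phi> s'"
    obtain u v w where s: "s = (u, v, w)" by (cases s) auto
    obtain u' v' w' where s': "s' = (u', v', w')" by (cases s') auto
    define y where "y i = (if i = k then u - u' else if i = Suc k then v - v' else w - w')" for i
    have "(\<Sum>i\<in>T. a i ^ (2 ^ j) * y i) = 0" if "j < 3" for j
    proof -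
      consider "j = 0" | "j = 1" | "j = 2" using \<open>j < 3\<close> by linarith
      then show ?thesis
        using eq by cases (simp_all add: Tset y_def s s' \<phi>_def algebra_simps power2_eq_square)
    qed
    note eqs = this
    have "y i = 0" if "i \<in> T" for i
      by (rule moore_kernel_trivial[OF two, of T a, OF _ _ _ eqs that]) (use nz in \<open>auto simp: T_def\<close>)
    from this[of k] this[of "Suc k"] this[of "Suc (Suc k)"]
    show "s = s'" by (simp add: Tset y_def s s')
  qed
  then have "surj \<phi>" by (intro finite_UNIV_inj_surj) simp_all
  then have "\<exists>s. \<phi> s = (a j, (a j)\<^sup>2, a j ^ 4)" for j
    by (metis surjD)
  then obtain s where s: "\<And>j. \<phi> (s j) = (a j, (a j)\<^sup>2, a j ^ 4)" by metis
  define Cf where "Cf i j = (if i = 0 then fst (s j) else if i = 1 then fst (snd (s j)) else snd (snd (s j)))"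
    for i j :: nat
  have Cf: "a k ^ (2 ^ p) * Cf 0 j + a (Suc k) ^ (2 ^ p) * Cf 1 j + a (Suc (Suc k)) ^ (2 ^ p) * Cf 2 j
      = a j ^ (2 ^ p)" if "p < 3" for p j
  proof -
    consider "p = 0" | "p = 1" | "p = 2" using \<open>p < 3\<close> by linarith
    then show ?thesis
      using s[of j] by cases (simp_all add: Cf_def \<phi>_def case_prod_beta)
  qed
  have "(\<Sum>i<k + 3. a i ^ (2 ^ p) * dh_symbol k Cf x i) = 0" if "p < 3" for x p
  proof -
    have "(\<Sum>i<k + 3. a i ^ (2 ^ p) * dh_symbol k Cf x i)
      = (\<Sum>i<k. a i ^ (2 ^ p) * x i) + (a k ^ (2 ^ p) * (\<Sum>j<k. Cf 0 j * x j)
        + a (Suc k) ^ (2 ^ p) * (\<Sum>j<k. Cf 1 j * x j) + a (Suc (Suc k)) ^ (2 ^ p) * (\<Sum>j<k. Cf 2 j * x j))"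
      by (simp add: dh_symbol_def numeral_3_eq_3 numeral_2_eq_2)
    also have "\<dots> = (\<Sum>j<k. a j ^ (2 ^ p) * x j + (a k ^ (2 ^ p) * Cf 0 j + a (Suc k) ^ (2 ^ p) * Cf 1 j
        + a (Suc (Suc k)) ^ (2 ^ p) * Cf 2 j) * x j)"
      by (simp add: sum.distrib sum_distrib_left distrib_right mult.assoc)
    also have "\<dots> = 0"
      by (simp only: Cf[OF that] char2_add_self[OF two] sum.neutral_const)
    finally show ?thesis .
  qed
  then show ?thesis by blast
qed

section \<open>Assembling the code from the check coefficients\<close>

lemma codeword_diff:
  "codeword k r h grp Cf (\<lambda>i. x i - y i) i = codeword k r h grp Cf x i - codeword k r h grp Cf y i"
proof -
  have "dh_symbol k Cf (\<lambda>i. x i - y i) i = dh_symbol k Cf x i - dh_symbol k Cf y i" for i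
    by (simp add: dh_symbol_def right_diff_distrib sum_subtractf)
  then show ?thesis by (simp add: codeword_def sum_subtractf)
qed

lemma codeword_cong:
  assumes "\<And>i. i < k \<Longrightarrow> x i = y i"
  shows "codeword k r h grp Cf x = codeword k r h grp Cf y"
proof -
  have "dh_symbol k Cf x i = dh_symbol k Cf y i" for i
    using assms by (simp add: dh_symbol_def)
  then show ?thesis by (simp add: codeword_def fun_eq_iff)
qed

text \<open>Groups are blocks of \<open>r\<close> consecutive symbols. A codeword with at most three
  nonzero surviving symbols satisfies, after elimination of the erased ones, a Moore system with
  trivial kernel, so it is zero.\<close>

lemma ex_maximally_recoverable:
  fixes \<beta> :: "nat \<Rightarrow> nat \<Rightarrow> 'a::{finite,field}"
  assumes two: "(2::'a) = 0" and k: "0 < k" and r: "0 < r" and dvd: "r dvd (k + 3)"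
    and \<beta>r: "\<And>g. \<beta> g r = 0"
    and \<beta>: "\<And>U e. U \<subseteq> {..<(k + 3) div r} \<times> {..r} \<Longrightarrow> U \<noteq> {} \<Longrightarrow> card U \<le> 3 \<Longrightarrow>
      (\<And>g i. (g, i) \<in> U \<Longrightarrow> e g \<le> r \<and> i \<noteq> e g) \<Longrightarrow> (\<Sum>(g, i)\<in>U. \<beta> g i + \<beta> g (e g)) \<noteq> 0"
  shows "\<exists>grp (Cf :: nat \<Rightarrow> nat \<Rightarrow> 'a).
    is_local_code_structure k r 3 grp \<and> maximally_recoverable k r 3 grp Cf"
proof -
  define l where "l = (k + 3) div r"
  have l: "num_groups k r 3 = l" by (simp add: num_groups_def l_def)
  have kl: "k + 3 = r * l" using dvd by (simp add: l_def)
  define n where "n = k + 3 + l"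
  have n: "code_length k r 3 = n" by (simp add: code_length_def l n_def)
  define grp where "grp i = i div r" for i
  \<comment> \<open>\<open>cg\<close> and \<open>ci\<close> give the group of a coordinate and its
    position there; a local parity gets position \<open>r\<close>, where \<beta> vanishes.\<close>
  define cg where "cg i = (if i < k + 3 then i div r else i - (k + 3))" for i
  define ci where "ci i = (if i < k + 3 then i mod r else r)" for i
  define a where "a i = \<beta> (cg i) (ci i)" for i
  have grp_less: "i div r < l" if "i < k + 3" for i
    using that r by (simp add: kl less_mult_imp_div_less mult.commute)
  have cg: "cg i < l" and ci: "ci i \<le> r" if "i < n" for i
    using that grp_less r by (auto simp: cg_def ci_def n_def less_imp_le)
  have inj: "i = i'" if "i < n" "i' < n" "cg i = cg i'" "ci i = ci i'" for i i'
  proof -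
    have "i mod r \<noteq> r" "i' mod r \<noteq> r" using r by (simp_all add: less_imp_neq)
    then have "i < k + 3 \<longleftrightarrow> i' < k + 3"
      using that(4) by (auto simp: ci_def split: if_splits)
    then show ?thesis
      using that unfolding cg_def ci_def
      by (cases "i < k + 3") (simp_all, metis div_mult_mod_eq)
  qed
  have group: "{i. i < k + 3 \<and> i div r = g} = {g * r..<g * r + r}" if "g < l" for g
  proof -
    have "(g + 1) * r \<le> l * r" using that by (intro mult_right_mono) auto
    then have le: "g * r + r \<le> k + 3" by (simp add: kl mult.commute)
    have iff: "i div r = g \<longleftrightarrow> g * r \<le> i \<and> i < g * r + r" for i
      using r by (metis add.commute div_nat_eqI dividend_less_div_times mult.commute mult_Suc
        times_div_less_eq_dividend)
    show ?thesis
      unfolding iff using le by (intro set_eqI iffI) simp_all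
  qed
  have struct: "is_local_code_structure k r 3 grp"
    unfolding is_local_code_structure_def l grp_def
    using r dvd grp_less group by simp
  have LG: "local_group k r 3 grp g = {i. i < n \<and> cg i = g}" if "g < l" for g
    using that by (auto simp: local_group_def grp_def cg_def n_def)
  have nonzero: "(\<Sum>i\<in>T. a i + a (e (cg i))) \<noteq> 0"
    if T: "T \<subseteq> {..<n}" "T \<noteq> {}" "card T \<le> 3"
      and e: "\<And>i. i \<in> T \<Longrightarrow> e (cg i) < n \<and> cg (e (cg i)) = cg i \<and> e (cg i) \<noteq> i" for T e
  proof -
    define U where "U = (\<lambda>i. (cg i, ci i)) ` T"
    have injT: "inj_on (\<lambda>i. (cg i, ci i)) T"
      using T(1) inj by (intro inj_onI) auto
    have "(\<Sum>(g, i)\<in>U. \<beta> g i + \<beta> g (ci (e g))) = (\<Sum>i\<in>T. a i + a (e (cg i)))"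
      unfolding U_def using e by (simp add: sum.reindex[OF injT] a_def)
    moreover have "(\<Sum>(g, i)\<in>U. \<beta> g i + \<beta> g (ci (e g))) \<noteq> 0"
    proof (rule \<beta>)
      show "U \<subseteq> {..<(k + 3) div r} \<times> {..r}"
        using T(1) cg ci by (auto simp: U_def l_def)
      show "card U \<le> 3" unfolding U_def using T(3) by (simp add: card_image[OF injT])
      fix g j assume "(g, j) \<in> U"
      then obtain i where i: "i \<in> T" "g = cg i" "j = ci i" by (auto simp: U_def)
      then have "i < n" using T(1) by auto
      then show "ci (e g) \<le> r \<and> j \<noteq> ci (e g)"
        using e[OF i(1)] inj[of i "e g"] ci i by metis
    qed (use T in \<open>auto simp: U_def\<close>)
    ultimately show ?thesis by simp
  qed
  have a_parity: "a i = 0" if "\<not> i < k + 3" for i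
    using that by (simp add: a_def ci_def \<beta>r)
  have "sum a U \<noteq> 0" if "U \<subseteq> {k..<k + 3}" "U \<noteq> {}" for U
  proof -
    have "card U \<le> 3" using card_mono[OF _ that(1)] by simp
    have U: "cg i < l" "i < k + 3" if "i \<in> U" for i
      using that \<open>U \<subseteq> _\<close> by (auto intro!: cg simp: n_def)
    \<comment> \<open>Choosing the local parities as erased symbols adds only zeros, so
      \<open>nonzero\<close> speaks about \<open>sum a U\<close> itself.\<close>
    have "(\<Sum>i\<in>U. a i + a (k + 3 + cg i)) \<noteq> 0"
    proof (rule nonzero[of U "\<lambda>g. k + 3 + g"])
      show "U \<subseteq> {..<n}" using U(2) by (force simp: n_def)
      fix i assume i: "i \<in> U"
      show "k + 3 + cg i < n \<and> cg (k + 3 + cg i) = cg i \<and> k + 3 + cg i \<noteq> i"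
        using U[OF i] by (simp add: n_def) (simp add: cg_def)
    qed (use that \<open>card U \<le> 3\<close> in auto)
    then show ?thesis by (simp add: a_parity)
  qed
  then obtain Cf where Cf: "\<And>x p. p < 3 \<Longrightarrow> (\<Sum>i<k + 3. a i ^ (2 ^ p) * dh_symbol k Cf x i) = 0"
    using ex_heavy_coefficients[OF two, of k a] by blast
  have "maximally_recoverable k r 3 grp Cf"
    unfolding maximally_recoverable_def n l
  proof (intro allI impI)
    fix E assume E: "E \<subseteq> {0..<n} \<and> (\<forall>g<l. card (E \<inter> local_group k r 3 grp g) = 1)"
    have "\<exists>i. E \<inter> {i. i < n \<and> cg i = g} = {i}" if "g < l" for g
      using E LG that by (metis card_1_singletonE)
    then obtain e where e: "\<And>g. g < l \<Longrightarrow> E \<inter> {i. i < n \<and> cg i = g} = {e g}" by metis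
    have en: "e g < n" "cg (e g) = g" "e g \<in> E" if "g < l" for g
      using e[OF that] by auto
    have Ee: "i \<in> E \<longleftrightarrow> i = e (cg i)" if "i < n" for i
      using e[OF cg[OF that]] that by auto
    have "E = e ` {..<l}"
    proof
      show "E \<subseteq> e ` {..<l}"
      proof
        fix i assume i: "i \<in> E"
        then have "i < n" using E by auto
        then show "i \<in> e ` {..<l}"
          using i Ee[of i] cg[of i] by (intro image_eqI[of _ _ "cg i"]) simp_all
      qed
      show "e ` {..<l} \<subseteq> E" using en(3) by blast
    qed
    moreover have "inj_on e {..<l}"
      by (rule inj_on_inverseI[of _ cg]) (simp add: en(2))
    ultimately have cardE: "card E = l" by (simp add: card_image)
    define S where "S = {0..<n} - E"
    have S: "finite S" "card S = k + 3"
      using E cardE finite_subset[of E "{0..<n}"] by (simp_all add: S_def card_Diff_subset n_def)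
    define enc where "enc x = (\<lambda>i. if i \<in> S then codeword k r 3 grp Cf x i else 0)" for x
    have heavy: "3 + 1 \<le> weight_on S (enc x)" if j: "j < k" "x j \<noteq> 0" for x j
    proof (rule ccontr)
      define y where "y = codeword k r 3 grp Cf x"
      define T where "T = {i \<in> S. y i \<noteq> 0}"
      assume "\<not> 3 + 1 \<le> weight_on S (enc x)"
      moreover have "weight_on S (enc x) = card T"
        unfolding weight_on_def enc_def T_def y_def by (rule arg_cong[where f = card]) auto
      ultimately have cardT: "card T \<le> 3" by simp
      have finT: "finite T" using S(1) by (simp add: T_def)
      have Tn: "i < n" "i \<noteq> e (cg i)" if "i \<in> T" for i
        using that Ee[of i] by (auto simp: T_def S_def)
      have sum_group: "(\<Sum>i | i < n \<and> cg i = g. y i) = 0" if "g < l" for g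
      proof -
        have "{i. i < n \<and> cg i = g} = insert (k + 3 + g) {i. i < k + 3 \<and> grp i = g}"
          using LG[OF that] by (simp add: local_group_def)
        then have "(\<Sum>i | i < n \<and> cg i = g. y i) = y (k + 3 + g) + (\<Sum>i | i < k + 3 \<and> grp i = g. y i)"
          by simp
        also have "y (k + 3 + g) = (\<Sum>i | i < k + 3 \<and> grp i = g. y i)"
          using that by (simp add: y_def codeword_def n n_def)
        finally show ?thesis by (simp add: char2_add_self[OF two])
      qed
      \<comment> \<open>Adding \<open>a (e g) ^ (2 ^ p)\<close> times the local check of each group
        to the heavy check gives these coefficients, by additivity of Frobenius, and cancels the
        erased symbols.\<close>
      have eqs: "(\<Sum>i\<in>T. (a i + a (e (cg i))) ^ (2 ^ p) * y i) = 0" if "p < 3" for p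
      proof -
        have split: "(\<Sum>g<l. \<Sum>i | i < n \<and> cg i = g. f i) = (\<Sum>i<n. f i)" for f :: "nat \<Rightarrow> 'a"
          using sum.group[of "{..<n}" "{..<l}" cg f] cg by auto
        have "(\<Sum>i\<in>T. (a i + a (e (cg i))) ^ (2 ^ p) * y i)
            = (\<Sum>i<n. (a i + a (e (cg i))) ^ (2 ^ p) * y i)"
        proof (rule sum.mono_neutral_left)
          show "\<forall>i\<in>{..<n} - T. (a i + a (e (cg i))) ^ (2 ^ p) * y i = 0"
          proof
            fix i assume i: "i \<in> {..<n} - T"
            show "(a i + a (e (cg i))) ^ (2 ^ p) * y i = 0"
            proof (cases "y i = 0")
              case False
              then have "e (cg i) = i" using i Ee[of i] by (auto simp: T_def S_def)
              then show ?thesis by (simp add: char2_add_self[OF two])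
            qed simp
          qed
        qed (use Tn in auto)
        also have "\<dots> = (\<Sum>i<n. a i ^ (2 ^ p) * y i) + (\<Sum>i<n. a (e (cg i)) ^ (2 ^ p) * y i)"
          by (simp add: char2_add_power[OF two] distrib_right sum.distrib)
        also have "(\<Sum>i<n. a (e (cg i)) ^ (2 ^ p) * y i)
            = (\<Sum>g<l. a (e g) ^ (2 ^ p) * (\<Sum>i | i < n \<and> cg i = g. y i))"
          unfolding split[symmetric] sum_distrib_left by (intro sum.cong) auto
        also have "\<dots> = 0" by (simp add: sum_group)
        also have "(\<Sum>i<n. a i ^ (2 ^ p) * y i) = (\<Sum>i<k + 3. a i ^ (2 ^ p) * y i)"
          by (rule sum.mono_neutral_right) (auto simp: n_def a_parity)
        also have "\<dots> = (\<Sum>i<k + 3. a i ^ (2 ^ p) * dh_symbol k Cf x i)"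
          by (rule sum.cong) (auto simp: y_def codeword_def)
        also have "\<dots> = 0" by (rule Cf[OF that])
        finally show ?thesis by simp
      qed
      have "y i = 0" if "i \<in> T" for i
      proof (rule moore_kernel_trivial[OF two finT cardT _ eqs that])
        fix U assume U: "U \<subseteq> T" "U \<noteq> {}"
        have "card U \<le> 3" using cardT card_mono[OF finT U(1)] by linarith
        show "(\<Sum>i\<in>U. a i + a (e (cg i))) \<noteq> 0"
        proof (rule nonzero)
          fix i assume "i \<in> U"
          then have "i \<in> T" using U by auto
          from Tn[OF this] cg[of i] en[of "cg i"]
          show "e (cg i) < n \<and> cg (e (cg i)) = cg i \<and> e (cg i) \<noteq> i" by simp
        qed (use U Tn(1) \<open>card U \<le> 3\<close> in auto)
      qed
      then have yS: "y i = 0" if "i \<in> S" for i using that by (auto simp: T_def)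
      \<comment> \<open>An erased symbol is the only one in its group that could still be nonzero,
        so the local check forces it to vanish.\<close>
      have "y i = 0" if i: "i < n" for i
      proof (cases "i \<in> E")
        case True
        then have ie: "i = e (cg i)" using Ee[OF i] by blast
        have "(\<Sum>i' | i' < n \<and> cg i' = cg i. y i') = (\<Sum>i'\<in>{i}. y i')"
        proof (rule sum.mono_neutral_right)
          show "\<forall>i'\<in>{i'. i' < n \<and> cg i' = cg i} - {i}. y i' = 0"
          proof
            fix i' assume i': "i' \<in> {i'. i' < n \<and> cg i' = cg i} - {i}"
            then have "i' < n" "i' \<noteq> e (cg i')" using ie by auto
            then have "i' \<notin> E" using Ee by blast
            then show "y i' = 0" using i' by (intro yS) (auto simp: S_def)
          qed
        qed (use i in auto)
        then show ?thesis using sum_group[OF cg[OF i]] by simp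
      qed (use yS i in \<open>auto simp: S_def\<close>)
      moreover have "y j = x j" using j by (simp add: y_def codeword_def dh_symbol_def)
      ultimately show False using j by (simp add: n_def)
    qed
    have "is_MDS_code S (range enc) (k + 3) k"
    proof (rule is_MDS_code_range[OF k S])
      show "enc (\<lambda>i. x i - y i) = (\<lambda>i. enc x i - enc y i)" for x y
        by (auto simp: enc_def codeword_diff)
      show "enc x = enc y" if "\<And>i. i < k \<Longrightarrow> x i = y i" for x y
        unfolding enc_def by (simp only: codeword_cong[of k x y r 3 grp Cf, OF that])
    qed (rule heavy)
    moreover have "punctured_code k r 3 grp Cf E = range enc"
      by (auto simp: punctured_code_def enc_def S_def n)
    ultimately show "is_MDS_code ({0..<n} - E) (punctured_code k r 3 grp Cf E) (k + 3) k"
      by (simp add: S_def)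
  qed
  with struct show ?thesis by blast
qed

theorem theorem17:
  fixes k r m t :: nat
  assumes "0 < k" and "0 < r" and "r dvd (k + 3)"
    and "m = (LEAST m. even m \<and> (k + 3) div r \<le> 2 ^ (r * m))"
    and "t = r * (3 * m div 2 + 1)"
    and "card (UNIV :: ('a::{finite,field}) set) = 2 ^ t"
  shows "\<exists>grp (Cf :: nat \<Rightarrow> nat \<Rightarrow> 'a).
           is_local_code_structure k r 3 grp \<and> maximally_recoverable k r 3 grp Cf"
proof -
  define l where "l = (k + 3) div r"
  \<comment> \<open>The even number \<open>2 * l\<close> meets the bound, so the minimum
    \<open>m\<close> is attained.\<close>
  have "l \<le> 2 ^ l" by (simp add: less_imp_le)
  also have "(2::nat) ^ l \<le> 2 ^ (r * (2 * l))"
    using \<open>0 < r\<close> by (intro power_increasing) auto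
  finally have "even (2 * l) \<and> l \<le> 2 ^ (r * (2 * l))" by simp
  then have m: "even m \<and> l \<le> 2 ^ (r * m)"
    unfolding assms(4) l_def[symmetric]
    by (rule LeastI[where P = "\<lambda>m. even m \<and> l \<le> 2 ^ (r * m)"])
  \<comment> \<open>With \<open>m = 2 * s\<close>, the factor \<open>3 * m div 2 + 1\<close> becomes
    \<open>3 * s + 1\<close>, the number of homogeneous coordinates of the cap.\<close>
  then obtain s where s: "m = 2 * s" by (elim conjE evenE)
  have card: "card (UNIV :: 'a set) = 2 ^ (r * (3 * s + 1))"
    using assms(5,6) by (simp add: s)
  have two: "(2::'a) = 0"
    using card \<open>0 < r\<close> by (intro two_eq_0_if_card_even) simp
  obtain \<beta> :: "nat \<Rightarrow> nat \<Rightarrow> 'a" where \<beta>r: "\<forall>g. \<beta> g r = 0" and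
    \<beta>: "\<forall>U e. U \<subseteq> {..<l} \<times> {..r} \<and> U \<noteq> {} \<and> card U \<le> 3 \<and> (\<forall>(g, i)\<in>U. e g \<le> r \<and> i \<noteq> e g) \<longrightarrow>
       (\<Sum>(g, i)\<in>U. \<beta> g i + \<beta> g (e g)) \<noteq> 0"
    using ex_check_coefficients[OF card \<open>0 < r\<close>, of l] m s by (elim exE conjE) auto
  show ?thesis
  proof (rule ex_maximally_recoverable[OF two assms(1-3), of \<beta>])
    show "\<beta> g r = 0" for g using \<beta>r by simp
  next
    fix U e
    assume "U \<subseteq> {..<(k + 3) div r} \<times> {..r}" "U \<noteq> {}" "card U \<le> 3"
      and "\<And>g i. (g, i) \<in> U \<Longrightarrow> e g \<le> r \<and> i \<noteq> e g"
    then show "(\<Sum>(g, i)\<in>U. \<beta> g i + \<beta> g (e g)) \<noteq> 0"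
      by (intro \<beta>[rule_format]) (auto simp: l_def)
  qed
qed

end
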